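(* Let $A$ be a Dedekind left brace whose additive group $(A,+)$ is not periodic. If $a \ast a = 0$ for each element $a\in A$, then $A$ is abelian.
   Context: A left brace is a triple $(A,+,\cdot)$ such that $(A,+)$ is an abelian group, $(A,\cdot)$ is a group, and $a\cdot(b+c)=a\cdot b+a\cdot c-a$ for all $a,b,c\in A$. The two groups have the same identity element, denoted $0$; products are also written by juxtaposition. The star operation is $a\ast b=ab-a-b$. A left brace $A$ is abelian if $a\ast b=0$ for all $a,b\in A$ (equivalently, $ab=a+b$ for all $a,b$). A non-empty subset $S\subseteq A$ is a subbrace if $(S,+)$ and $(S,\cdot)$ are subgroups of $(A,+)$ and $(A,\cdot)$ respectively. A subbrace $I$ is an ideal of $A$ if $a\ast x\in I$ and $x\ast a\in I$ for all $a\in A$, $x\in I$. A left brace $A$ is Dedekind if every subbrace of $A$ is an ideal of $A$. A group is periodic if each of its elements has finite order. *)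

theory Defs
  imports "HOL-Algebra.Multiplicative_Group"
begin

text \<open>
  A left brace is a structure over the record type of rings: \<open>\<oplus>\<close>, \<open>\<zero>\<close> give the additive group
  and \<open>\<otimes>\<close>, \<open>\<one>\<close> the multiplicative group, which here is defined on the whole carrier.
  That \<open>\<one> = \<zero>\<close> is a consequence, see \<open>one_eq_zero\<close> below.
\<close>

locale left_brace = abelian_group A + group A for A (structure) +
  assumes brace_distrib:
    "\<lbrakk>a \<in> carrier A; b \<in> carrier A; c \<in> carrier A\<rbrakk>
      \<Longrightarrow> a \<otimes> (b \<oplus> c) = ((a \<otimes> b) \<oplus> (a \<otimes> c)) \<ominus> a"

lemma (in left_brace) one_eq_zero: "\<one> = \<zero>"
proof -
  have "\<one> \<otimes> (\<zero> \<oplus> \<zero>) = ((\<one> \<otimes> \<zero>) \<oplus> (\<one> \<otimes> \<zero>)) \<ominus> \<one>"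
    by (rule brace_distrib) auto
  then have "\<zero> = \<zero> \<ominus> \<one>"
    by simp
  then show ?thesis
    by (metis a_minus_def add.inv_closed add.inv_eq_1_iff add.l_one one_closed)
qed

definition brace_star :: "('a, 'm) ring_scheme \<Rightarrow> 'a \<Rightarrow> 'a \<Rightarrow> 'a" (infixl \<open>\<star>\<index>\<close> 70)
  where "a \<star>\<^bsub>A\<^esub> b = ((a \<otimes>\<^bsub>A\<^esub> b) \<ominus>\<^bsub>A\<^esub> a) \<ominus>\<^bsub>A\<^esub> b"

definition abelian_brace :: "('a, 'm) ring_scheme \<Rightarrow> bool"
  where "abelian_brace A \<longleftrightarrow>
    left_brace A \<and> (\<forall>a\<in>carrier A. \<forall>b\<in>carrier A. a \<star>\<^bsub>A\<^esub> b = \<zero>\<^bsub>A\<^esub>)"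

definition subbrace :: "'a set \<Rightarrow> ('a, 'm) ring_scheme \<Rightarrow> bool"
  where "subbrace S A \<longleftrightarrow> additive_subgroup S A \<and> subgroup S A"

definition brace_ideal :: "'a set \<Rightarrow> ('a, 'm) ring_scheme \<Rightarrow> bool"
  where "brace_ideal I A \<longleftrightarrow>
    subbrace I A \<and> (\<forall>a\<in>carrier A. \<forall>x\<in>I. a \<star>\<^bsub>A\<^esub> x \<in> I \<and> x \<star>\<^bsub>A\<^esub> a \<in> I)"

definition dedekind_brace :: "('a, 'm) ring_scheme \<Rightarrow> bool"
  where "dedekind_brace A \<longleftrightarrow> left_brace A \<and> (\<forall>S. subbrace S A \<longrightarrow> brace_ideal S A)"

text \<open>The library's \<^const>\<open>group.ord\<close> is \<open>0\<close> exactly on the elements of infinite order.\<close>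

definition periodic_group :: "('a, 'm) monoid_scheme \<Rightarrow> bool"
  where "periodic_group G \<longleftrightarrow> group G \<and> (\<forall>x\<in>carrier G. group.ord G x \<noteq> 0)"

end

theory Submission
  imports Defs "HOL-Algebra.Elementary_Groups"
begin

text \<open>
  Write \<open>\<lambda>\<^sub>a(b) = ab - a\<close>. Each \<open>\<lambda>\<^sub>a\<close> is an endomorphism of the additive group, and
  \<open>a \<star> b = \<lambda>\<^sub>a(b) - b\<close>, so the claim is that every \<open>\<lambda>\<^sub>a\<close> is the identity.

  The hypothesis \<open>a \<star> a = \<zero>\<close> says that \<open>\<lambda>\<^sub>a\<close> fixes \<open>a\<close>, and hence all additive multiples of \<open>a\<close>.
  It follows that the multiplicative powers of \<open>a\<close> are its additive multiples
  (\<open>int_pow_eq_add_pow\<close>), so \<open>\<int>a\<close> is a subbrace, and an ideal because the brace is Dedekind.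
  This confines both \<open>a \<star> b\<close> and \<open>b \<star> a\<close> to \<open>\<int>a\<close> (\<open>dedekind_star_in_multiples\<close>), with two
  consequences.

  \<^item> Every \<open>\<lambda>\<^sub>b\<close> maps each cyclic additive subgroup into itself. Such endomorphisms are very rigid:
    as soon as one fixes a single element of infinite order, it is the identity
    (\<open>cyclic_preserving_endo_fixing_infinite_order_eq_id\<close>).

  \<^item> The element \<open>b \<star> x\<close> lies in \<open>\<int>b \<inter> \<int>x\<close>. If \<open>b\<close> has finite additive order and \<open>x\<close> has infinite
    order, this intersection is zero, so \<open>\<lambda>\<^sub>b\<close> fixes \<open>x\<close>.

  An element of infinite order fixed by \<open>\<lambda>\<^sub>b\<close> therefore always exists: \<open>b\<close> itself if its order is
  infinite, and otherwise any \<open>x\<close> that witnesses that the additive group is not periodic.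
\<close>

text \<open>
  In additive notation, let \<open>h y = ky\<close> and \<open>h (x + y) = m(x + y)\<close>. Additivity of \<open>h\<close> gives
  \<open>(m - 1)x = (k - m)y\<close>. If \<open>m = 1\<close>, this reads \<open>ky = y\<close>. Otherwise \<open>x\<close> and \<open>y\<close> have a common
  non-zero multiple, which makes the order of \<open>y\<close> infinite; since \<open>h\<close> fixes this multiple as a
  multiple of \<open>x\<close> and scales it by \<open>k\<close> as a multiple of \<open>y\<close>, again \<open>k = 1\<close>.
\<close>

lemma (in comm_group) cyclic_preserving_endo_fixing_infinite_order_eq_id:
  assumes h: "h \<in> hom G G"
    and cyc: "\<And>y. y \<in> carrier G \<Longrightarrow> \<exists>k::int. h y = y [^] k"
    and x: "x \<in> carrier G" "ord x = 0" "h x = x"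
    and y: "y \<in> carrier G"
  shows "h y = y"
proof -
  obtain k :: int where k: "h y = y [^] k"
    using cyc y by blast
  obtain m :: int where m: "h (x \<otimes> y) = (x \<otimes> y) [^] m"
    using cyc x y by blast
  have "x \<otimes> y [^] k = x [^] m \<otimes> y [^] m"
    using m h x y by (simp add: hom_mult k int_pow_distrib)
  moreover have "x [^] m = x \<otimes> x [^] (m - 1)" "y [^] k = y [^] (k - m) \<otimes> y [^] m"
    using x y int_pow_mult[of x 1 "m - 1"] int_pow_mult[of y "k - m" m] by simp_all
  ultimately have "x \<otimes> (y [^] (k - m) \<otimes> y [^] m) = x \<otimes> (x [^] (m - 1) \<otimes> y [^] m)"
    using x y by (simp add: m_assoc)
  then have xy: "x [^] (m - 1) = y [^] (k - m)"
    using x y by simp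
  show ?thesis
  proof (cases "m = 1")
    case True
    then have "y [^] (k - 1) = \<one>"
      using xy by simp
    then show ?thesis
      using k y int_pow_mult[of y 1 "k - 1"] by simp
  next
    case False
    have y0: "ord y = 0"
    proof -
      have "x [^] ((m - 1) * int (ord y)) = (y [^] int (ord y)) [^] (k - m)"
        using x y xy by (metis int_pow_pow mult.commute)
      also have "\<dots> = \<one>"
        using y by (simp add: int_pow_int)
      finally show ?thesis
        using x False by (simp add: int_pow_eq_id)
    qed
    have "k \<noteq> m"
      using xy False x by (auto simp: int_pow_eq_id)
    \<comment> \<open>The image under \<open>h\<close> of the common power of \<open>x\<close> and \<open>y\<close>, computed in both ways.\<close>
    have "y [^] (k * (k - m)) = h (y [^] (k - m))"
      using hom_int_pow[OF h y] k y by (simp add: int_pow_pow is_group)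
    also have "\<dots> = h (x [^] (m - 1))"
      using xy by simp
    also have "\<dots> = x [^] (m - 1)"
      using hom_int_pow[OF h] x by (simp add: is_group)
    also have "\<dots> = y [^] (k - m)"
      by (fact xy)
    finally have "k * (k - m) = k - m"
      using y y0 by (simp add: int_pow_eq)
    then have "k = 1"
      using \<open>k \<noteq> m\<close> by simp
    then show ?thesis
      using k y by simp
  qed
qed

context left_brace
begin

definition brace_lambda :: "'a \<Rightarrow> 'a \<Rightarrow> 'a"
  where "brace_lambda a b = (a \<otimes> b) \<ominus> a"

lemma brace_lambda_closed [simp]:
  "\<lbrakk>a \<in> carrier A; b \<in> carrier A\<rbrakk> \<Longrightarrow> brace_lambda a b \<in> carrier A"
  by (simp add: brace_lambda_def)

lemma mult_eq_add_brace_lambda: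
  "\<lbrakk>a \<in> carrier A; b \<in> carrier A\<rbrakk> \<Longrightarrow> a \<otimes> b = a \<oplus> brace_lambda a b"
  by (simp add: brace_lambda_def a_minus_def a_comm[of "a \<otimes> b"] r_neg1 r_neg2)

lemma star_eq_brace_lambda:
  "\<lbrakk>a \<in> carrier A; b \<in> carrier A\<rbrakk> \<Longrightarrow> a \<star> b = brace_lambda a b \<ominus> b"
  by (simp add: brace_star_def brace_lambda_def)

lemma star_eq_zero_iff:
  "\<lbrakk>a \<in> carrier A; b \<in> carrier A\<rbrakk> \<Longrightarrow> a \<star> b = \<zero> \<longleftrightarrow> brace_lambda a b = b"
  by (simp add: star_eq_brace_lambda a_minus_def add.inv_solve_right')

lemma brace_lambda_hom:
  assumes a: "a \<in> carrier A"
  shows "brace_lambda a \<in> hom (add_monoid A) (add_monoid A)"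
  using a by (auto simp: hom_def brace_lambda_def brace_distrib a_minus_def a_ac)

lemma brace_lambda_add_pow:
  "\<lbrakk>a \<in> carrier A; b \<in> carrier A\<rbrakk>
    \<Longrightarrow> brace_lambda a ([(k::int)] \<cdot> b) = [k] \<cdot> brace_lambda a b"
  using hom_int_pow[OF brace_lambda_hom, of a b k] a_group by (simp add: add_pow_def)

text \<open>
  Since \<open>\<lambda>\<^sub>a\<close> fixes every multiple of \<open>a\<close>, multiplying such a multiple by \<open>a\<close> on the left merely
  adds \<open>a\<close>. Iterating from \<open>\<zero> = \<one>\<close> gives the natural powers, and iterating from \<open>-na\<close> shows that
  \<open>-na\<close> is the inverse of \<open>a\<^sup>n\<close>.
\<close>

lemma int_pow_eq_add_pow:
  assumes a: "a \<in> carrier A" and self: "a \<star> a = \<zero>"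
  shows "a [^] (k::int) = [k] \<cdot> a"
proof -
  have step: "a \<otimes> ([j] \<cdot> a) = [(1 + j)] \<cdot> a" for j :: int
    using a self
    by (simp add: mult_eq_add_brace_lambda brace_lambda_add_pow star_eq_zero_iff add.int_pow_mult)
  have shift: "a [^] n \<otimes> ([j] \<cdot> a) = [(int n + j)] \<cdot> a" for n :: nat and j :: int
  proof (induction n arbitrary: j)
    case (Suc n)
    then show ?case
      using a by (simp add: m_assoc step add.int_pow_closed algebra_simps)
  qed (use a in \<open>simp add: add.int_pow_closed\<close>)
  have nat: "a [^] n = [(int n)] \<cdot> a" for n :: nat
    using shift[of n 0] a by (simp add: add_pow_def flip: one_eq_zero)
  show ?thesis
  proof (cases k rule: int_cases2)
    case (nonneg n)
    then show ?thesis
      by (simp add: int_pow_int nat)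
  next
    case (nonpos n)
    have "a [^] n \<otimes> ([k] \<cdot> a) = \<one>"
      using shift[of n k] nonpos by (simp add: add_pow_def one_eq_zero)
    then show ?thesis
      using a nonpos by (metis add.int_pow_closed int_pow_neg_int inv_unique' nat_pow_closed inv_comm inv_equality)
  qed
qed

text \<open>
  One and the same set is the cyclic subgroup generated by \<open>a\<close> in either group.
\<close>

lemma subbrace_add_multiples:
  assumes a: "a \<in> carrier A" and self: "a \<star> a = \<zero>"
  shows "subbrace (range (\<lambda>k::int. [k] \<cdot> a)) A"
proof -
  have "additive_subgroup (range (\<lambda>k::int. [k] \<cdot> a)) A"
    using group.subgroup_of_powers[OF a_group, of a] a
    by (simp add: additive_subgroup_def add_pow_def)
  moreover have "subgroup (range (\<lambda>k::int. a [^] k)) A"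
    using a by (rule subgroup_of_powers)
  ultimately show ?thesis
    using assms by (simp add: subbrace_def int_pow_eq_add_pow)
qed

end

text \<open>
  The two conclusions play different roles: the one for \<open>b \<star> a\<close> says that \<open>\<lambda>\<^sub>b\<close> maps the additive
  cyclic group of \<open>a\<close> into itself; combined with the one for \<open>a \<star> b\<close>, it puts every star product
  into the intersection of the cyclic groups of its two factors.
\<close>

lemma dedekind_star_in_multiples:
  fixes A :: "('a, 'm) ring_scheme" (structure)
  assumes ded: "dedekind_brace A"
    and a: "a \<in> carrier A" and self: "a \<star> a = \<zero>" and b: "b \<in> carrier A"
  shows "\<exists>k::int. a \<star> b = [k] \<cdot> a" "\<exists>k::int. b \<star> a = [k] \<cdot> a"
proof -
  interpret left_brace A
    using ded by (simp add: dedekind_brace_def)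
  have "brace_ideal (range (\<lambda>k::int. [k] \<cdot> a)) A"
    using ded subbrace_add_multiples[OF a self] by (simp add: dedekind_brace_def)
  moreover have "a \<in> range (\<lambda>k::int. [k] \<cdot> a)"
    using a by (metis add.int_pow_1 rangeI)
  ultimately show "\<exists>k::int. a \<star> b = [k] \<cdot> a" "\<exists>k::int. b \<star> a = [k] \<cdot> a"
    using b unfolding brace_ideal_def by blast+
qed

theorem theorem1:
  fixes A :: "('a, 'm) ring_scheme" (structure)
  assumes "dedekind_brace A"
    and "\<not> periodic_group (add_monoid A)"
    and "\<And>a. a \<in> carrier A \<Longrightarrow> a \<star> a = \<zero>"
  shows "abelian_brace A"
proof -
  interpret left_brace A
    using assms(1) by (simp add: dedekind_brace_def)
  obtain x where x: "x \<in> carrier A" and ord_x: "add.ord x = 0"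
    using assms(2) a_group by (auto simp: periodic_group_def)
  have "b \<star> y = \<zero>" if b: "b \<in> carrier A" and y: "y \<in> carrier A" for b y
  proof -
    have cyc: "\<exists>k::int. brace_lambda b z = z [^]\<^bsub>add_monoid A\<^esub> k" if z: "z \<in> carrier A" for z
    proof -
      obtain k :: int where "b \<star> z = [k] \<cdot> z"
        using dedekind_star_in_multiples(2)[OF assms(1) z assms(3)[OF z] b] by blast
      then have "brace_lambda b z \<ominus> z \<oplus> z = [k] \<cdot> z \<oplus> z"
        using b z by (simp add: star_eq_brace_lambda)
      then have "brace_lambda b z = [(k + 1)] \<cdot> z"
        using b z by (simp add: a_minus_def a_assoc l_neg add.int_pow_mult)
      then show ?thesis
        by (auto simp: add_pow_def)
    qed
    have "\<exists>w\<in>carrier A. add.ord w = 0 \<and> brace_lambda b w = w"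
    proof (cases "add.ord b = 0")
      case True
      then show ?thesis
        using b assms(3)[OF b] by (auto simp: star_eq_zero_iff)
    next
      case False
      obtain i j :: int where i: "b \<star> x = [i] \<cdot> b" and j: "b \<star> x = [j] \<cdot> x"
        using dedekind_star_in_multiples[OF assms(1) _ assms(3)] b x by metis
      \<comment> \<open>The order of \<open>b\<close> annihilates \<open>b \<star> x = ib = jx\<close>, and \<open>x\<close> is torsion-free, so \<open>j = 0\<close>.\<close>
      have "[(j * int (add.ord b))] \<cdot> x = [i] \<cdot> ([(int (add.ord b))] \<cdot> b)"
        using i j x b by (metis add.int_pow_pow mult.commute)
      also have "\<dots> = \<zero>"
        using b add.int_pow_eq_id[of b "int (add.ord b)"] by simp
      finally have "j = 0"
        using add.int_pow_eq_id[of x] x ord_x False by simp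
      then have "b \<star> x = \<zero>"
        using j by (simp add: add_pow_def)
      then show ?thesis
        using b x ord_x by (auto simp: star_eq_zero_iff)
    qed
    then obtain w where "w \<in> carrier A" "add.ord w = 0" "brace_lambda b w = w"
      by blast
    then have "brace_lambda b y = y"
      using comm_group.cyclic_preserving_endo_fixing_infinite_order_eq_id
          [OF a_comm_group brace_lambda_hom[OF b], of w y] cyc y by simp
    then show ?thesis
      using b y by (simp add: star_eq_zero_iff)
  qed
  then show ?thesis
    by (simp add: abelian_brace_def left_brace_axioms)
qed

end
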